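(* Let $D \subset \mathbb{C}$ be a Jordan domain, and let $f$ be analytic on the closure $\mathrm{cl}(D)$. Then there exist a polynomial $p \in \mathbb{C}[z]$ and an injective analytic map $\phi : D \to \mathbb{C}$ such that $f(z) = p(\phi(z))$ for all $z \in D$.
   Context: A Jordan domain is the bounded component of the complement in $\mathbb{C}$ of a Jordan curve (simple closed curve). To say that $f$ is analytic on the compact set $\mathrm{cl}(D)$ means that $f$ is a complex-valued function that is analytic on some open set $\mathcal{O} \subset \mathbb{C}$ containing $\mathrm{cl}(D)$. *)

theory Defs
  imports "HOL-Complex_Analysis.Complex_Analysis" "HOL-Computational_Algebra.Polynomial"
begin

definition Jordan_domain :: "complex set \<Rightarrow> bool" where
  "Jordan_domain D \<longleftrightarrow>
     (\<exists>\<gamma>. simple_path \<gamma> \<and> pathfinish \<gamma> = pathstart \<gamma> \<and>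
          D \<in> components (- path_image \<gamma>) \<and> bounded D)"

end

theory Submission
  imports Defs "HOL-Computational_Algebra.Fundamental_Theorem_Algebra"
begin

text \<open>
  The closure of \<open>D\<close> has a simply connected open neighbourhood on which \<open>f\<close> is holomorphic, so by
  the Riemann mapping theorem one may replace \<open>f\<close> by a holomorphic function \<open>F\<close> on the unit disc and
  \<open>D\<close> by a smaller concentric disc. There \<open>F' = Q k\<close> with a polynomial \<open>Q\<close> and a zero-free \<open>k\<close>.
  Write \<open>F = h + Q\<^sup>2 g\<close> with a polynomial \<open>h\<close> and approximate \<open>g\<close> by a Taylor polynomial \<open>q\<close>. Then
  \<open>p = h + Q\<^sup>2 q\<close> satisfies \<open>p = F - F'\<^sup>2 \<epsilon>\<close> with a small holomorphic \<open>\<epsilon>\<close>: it agrees with \<open>F\<close> at the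
  critical points to so high an order that \<open>F (w + e w) = p w\<close> has a small holomorphic solution of
  the form \<open>e = F' u\<close>. Being close to the identity, \<open>w \<mapsto> w + e w\<close> is invertible, and its inverse
  is the required \<open>\<phi>\<close>.
\<close>

section \<open>Planar topology: simply connected neighbourhoods and Jordan domains\<close>

text \<open>Since \<open>- K\<close> is connected, every point outside \<open>S\<close> can be
  joined to infinity without meeting \<open>K\<close>. Removing such channels from \<open>S\<close>
  opens all its holes, and the piece around \<open>K\<close> that remains has a connected unbounded
  complement.\<close>

lemma simply_connected_nbhd:
  fixes K S :: "complex set"
  assumes "compact K" "connected K" "connected (- K)" "open S" "K \<subseteq> S"
  obtains U where "open U" "simply_connected U" "bounded U" "K \<subseteq> U" "U \<subseteq> S"
proof (cases "K = {}")
  case True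
  then show ?thesis using that[of "{}"] by simp
next
  case False
  then obtain k where "k \<in> K" by blast
  obtain r where "0 < r" and Kr: "K \<subseteq> ball 0 r"
    using assms(1) compact_imp_bounded bounded_subset_ballD by metis
  \<comment> \<open>Lying on the circle of radius \<open>r\<close>, the point \<open>a\<close> is
    outside \<open>ball 0 r\<close> and hence not in \<open>K\<close>. It is the common point that
    will tie all the channels to the exterior of the disc.\<close>
  define a where "a = complex_of_real r"
  have a_norm: "norm a = r" using \<open>0 < r\<close> by (simp add: a_def)
  have "open (- K)" using assms(1) compact_imp_closed by blast
  \<comment> \<open>Each \<open>N\<close> is a path from \<open>a\<close> to \<open>x\<close> inside
    \<open>- K\<close>, enlarged by a closed disc about \<open>x\<close>.\<close>
  have "\<exists>N d. 0 < d \<and> ball x d \<subseteq> N \<and> compact N \<and> connected N \<and> a \<in> N \<and> N \<inter> K = {}"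
    if "x \<in> cball 0 r - S" for x
  proof -
    have x: "x \<in> - K" and a: "a \<in> - K" using that assms(5) Kr a_norm by auto
    have "path_connected (- K)"
      using \<open>open (- K)\<close> assms(3) connected_open_path_connected by blast
    then obtain g where g: "path g" "path_image g \<subseteq> - K" "pathstart g = a" "pathfinish g = x"
      using x a unfolding path_connected_def by blast
    obtain d where d: "0 < d" "cball x d \<subseteq> - K"
      using \<open>open (- K)\<close> x open_contains_cball by blast
    have "x \<in> path_image g" "a \<in> path_image g"
      using g(3,4) pathfinish_in_path_image pathstart_in_path_image by blast+
    have "connected (path_image g \<union> cball x d)"
      using g(1) \<open>x \<in> path_image g\<close> d(1)
      by (intro connected_Un connected_path_image convex_connected) auto
    moreover have "compact (path_image g \<union> cball x d)"
      using g(1) by (simp add: compact_Un compact_path_image)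
    moreover have "ball x d \<subseteq> path_image g \<union> cball x d"
      using ball_subset_cball by blast
    ultimately show ?thesis
      using d g(2) \<open>a \<in> path_image g\<close> by blast
  qed
  then obtain N d where Nd: "\<And>x. x \<in> cball 0 r - S \<Longrightarrow> 0 < d x \<and> ball x (d x) \<subseteq> N x \<and>
      compact (N x) \<and> connected (N x) \<and> a \<in> N x \<and> N x \<inter> K = {}"
    by metis
  \<comment> \<open>Compactness reduces to finitely many channels, so that their union stays
    closed.\<close>
  have "compact (cball 0 r - S)"
    using assms(4) by (simp add: compact_diff)
  moreover have "cball 0 r - S \<subseteq> (\<Union>x\<in>cball 0 r - S. ball x (d x))"
    using Nd by force
  ultimately obtain T where T: "T \<subseteq> cball 0 r - S" "finite T" "cball 0 r - S \<subseteq> (\<Union>x\<in>T. ball x (d x))"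
    using compactE_image[of "cball 0 r - S" "cball 0 r - S" "\<lambda>x. ball x (d x)"] by auto
  \<comment> \<open>\<open>C\<close> is connected and contains \<open>- S\<close>: finitely many discs covering the bounded part of \<open>- S\<close> are
    joined to infinity inside \<open>- K\<close>. Hence the components of \<open>- C\<close> have no holes.\<close>
  define C where "C = - ball 0 r \<union> (\<Union>x\<in>T. N x)"
  have "closed C"
    unfolding C_def using T Nd by (intro closed_Un closed_UN) (auto simp: compact_imp_closed)
  have "connected (- ball (0::complex) r)"
    by (rule connected_complement_bounded_convex) auto
  have "C = \<Union> (insert (- ball 0 r) (N ` T))" by (auto simp: C_def)
  moreover have "connected (\<Union> (insert (- ball 0 r) (N ` T)))"
  proof (rule connected_Union)
    show "connected s" if "s \<in> insert (- ball 0 r) (N ` T)" for s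
      using that T Nd \<open>connected (- ball (0::complex) r)\<close> by blast
    have "a \<in> \<Inter> (insert (- ball 0 r) (N ` T))"
      using T Nd a_norm by auto
    then show "\<Inter> (insert (- ball 0 r) (N ` T)) \<noteq> {}" by blast
  qed
  ultimately have "connected C" by simp
  have "C \<inter> K = {}" using T Nd Kr unfolding C_def by blast
  have "- S \<subseteq> C"
  proof
    fix x assume "x \<in> - S"
    show "x \<in> C"
    proof (cases "x \<in> ball 0 r")
      case True
      then have "x \<in> cball 0 r - S" using \<open>x \<in> - S\<close> by auto
      then obtain y where "y \<in> T" "x \<in> ball y (d y)" using T by blast
      then have "x \<in> N y" using T Nd by blast
      then show ?thesis using \<open>y \<in> T\<close> by (auto simp: C_def)
    qed (simp add: C_def)
  qed
  define U where "U = connected_component_set (- C) k"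
  have "k \<in> - C" using \<open>k \<in> K\<close> \<open>C \<inter> K = {}\<close> by blast
  have "open U" unfolding U_def using \<open>closed C\<close> by (simp add: open_connected_component open_Compl)
  have "U \<subseteq> - C" unfolding U_def by (rule connected_component_subset)
  have "U \<subseteq> ball 0 r" using \<open>U \<subseteq> - C\<close> unfolding C_def by blast
  then have "bounded U" using bounded_ball bounded_subset by blast
  have "K \<subseteq> U" unfolding U_def
    using \<open>k \<in> K\<close> \<open>C \<inter> K = {}\<close> assms(2) by (intro connected_component_maximal) auto
  have "U \<in> components (- C)"
    unfolding U_def using \<open>k \<in> - C\<close> by (rule componentsI)
  \<comment> \<open>Deleting one component of the complement of a connected set leaves a connected
    set. Thus \<open>- U\<close> has itself as its only component, and it is unbounded because
    \<open>U\<close> is bounded.\<close>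
  then have "connected (- U)"
    using component_complement_connected \<open>connected C\<close> by blast
  have "\<not> bounded (- U)"
    using \<open>bounded U\<close> cobounded_imp_unbounded by blast
  have "connected U" by (simp add: U_def)
  have "simply_connected U"
    unfolding simply_connected_eq_unbounded_complement_components[OF \<open>open U\<close>]
  proof (intro conjI ballI \<open>connected U\<close>)
    fix W assume "W \<in> components (- U)"
    then have "W = - U"
      using \<open>connected (- U)\<close> \<open>\<not> bounded (- U)\<close> components_eq_sing_iff[of "- U"] by auto
    then show "\<not> bounded W" using \<open>\<not> bounded (- U)\<close> by simp
  qed
  then show ?thesis
    using that \<open>open U\<close> \<open>bounded U\<close> \<open>K \<subseteq> U\<close> \<open>U \<subseteq> - C\<close> \<open>- S \<subseteq> C\<close> by blast
qed

text \<open>By the Jordan curve theorem the bounded component is the inside of the curve, with the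
  curve as its frontier. The complement of the closure is therefore exactly the connected
  outside.\<close>

lemma closure_Jordan_component:
  fixes \<gamma> :: "real \<Rightarrow> complex"
  assumes "simple_path \<gamma>" "pathfinish \<gamma> = pathstart \<gamma>" "D \<in> components (- path_image \<gamma>)" "bounded D"
  shows "open D" "compact (closure D)" "connected (closure D)" "connected (- closure D)"
proof -
  let ?P = "path_image \<gamma>"
  note J = Jordan_inside_outside[OF assms(1,2)]
  have "D \<subseteq> inside ?P"
  proof
    fix x assume "x \<in> D"
    obtain y where y: "D = connected_component_set (- ?P) y"
      using assms(3) unfolding components_def by blast
    then have "connected_component_set (- ?P) x = D"
      using \<open>x \<in> D\<close> connected_component_eq by metis
    moreover have "x \<notin> ?P"
      using \<open>x \<in> D\<close> assms(3) in_components_subset by blast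
    ultimately show "x \<in> inside ?P" using assms(4) by (simp add: inside_def)
  qed
  have "D \<noteq> {}" using assms(3) in_components_nonempty by blast
  have "inside ?P \<subseteq> D"
    using components_maximal[OF assms(3), of "inside ?P"] J \<open>D \<subseteq> inside ?P\<close> \<open>D \<noteq> {}\<close> by blast
  then have D: "D = inside ?P" using \<open>D \<subseteq> inside ?P\<close> by blast
  show "open D" using D J by simp
  show "compact (closure D)" using assms(4) by simp
  show "connected (closure D)" using assms(3) in_components_connected connected_imp_connected_closure by blast
  have "closure D = inside ?P \<union> ?P"
    using D J closure_Un_frontier by metis
  then have "- closure D = outside ?P"
    using J by blast
  then show "connected (- closure D)" using J by simp
qed

section \<open>Polynomials and holomorphic functions: approximation, division, factorization\<close>

lemma poly_approximation:
  fixes g :: "complex \<Rightarrow> complex"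
  assumes "g holomorphic_on ball 0 R" "r < R" "0 < e"
  obtains p :: "complex poly" where "\<And>z. z \<in> cball 0 r \<Longrightarrow> norm (g z - poly p z) < e"
proof (cases "0 \<le> r")
  case False
  then show ?thesis using that[of 0] by auto
next
  case True
  define c where "c n = (deriv ^^ n) g 0 / fact n" for n
  have sums: "(\<lambda>n. c n * z ^ n) sums g z" if "z \<in> ball 0 R" for z
    using holomorphic_power_series[OF assms(1) that] by (simp add: c_def)
  \<comment> \<open>Convergence at the single point \<open>s\<close>, beyond \<open>r\<close>,
    forces the radius of convergence above \<open>r\<close>, which yields uniform convergence on
    \<open>cball 0 r\<close>.\<close>
  define s where "s = (r + R) / 2"
  have s: "r < s" "s < R" using assms(2) by (auto simp: s_def)
  have "ereal (norm (complex_of_real s)) \<le> conv_radius c"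
    using s True by (intro conv_radius_geI sums_summable[OF sums]) auto
  moreover have "ereal r < ereal (norm (complex_of_real s))"
    using s True by simp
  ultimately have "ereal r < conv_radius c"
    using less_le_trans by blast
  then have "uniform_limit (cball 0 r) (\<lambda>n x. \<Sum>i<n. c i * (x - 0) ^ i) (\<lambda>x. \<Sum>i. c i * (x - 0) ^ i) sequentially"
    by (rule powser_uniform_limit)
  then have "\<forall>\<^sub>F n in sequentially. \<forall>x\<in>cball 0 r. dist (\<Sum>i<n. c i * x ^ i) (\<Sum>i. c i * x ^ i) < e"
    using uniform_limitD[OF _ assms(3)] by force
  then obtain n where n: "\<And>x. x \<in> cball 0 r \<Longrightarrow> dist (\<Sum>i<n. c i * x ^ i) (\<Sum>i. c i * x ^ i) < e"
    using eventually_happens'[OF sequentially_bot] by blast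
  show ?thesis
  proof (rule that[of "\<Sum>i<n. monom (c i) i"])
    fix z :: complex assume z: "z \<in> cball 0 r"
    then have "z \<in> ball 0 R" using assms(2) by auto
    then have "(\<Sum>i. c i * z ^ i) = g z" using sums sums_unique by metis
    then show "norm (g z - poly (\<Sum>i<n. monom (c i) i) z) < e"
      using n[OF z] by (simp add: poly_sum poly_monom dist_norm norm_minus_commute)
  qed
qed

text \<open>One linear factor of \<open>Q\<close> is divided out at a time: subtracting the value at
  a root \<open>a\<close> makes the difference divisible by \<open>z - a\<close>, and the constants
  collected on the way build up \<open>h\<close>.\<close>

lemma holomorphic_division_poly:
  fixes Q :: "complex poly"
  assumes "F holomorphic_on S" "open S" "Q \<noteq> 0"
  obtains h :: "complex poly" and g where "g holomorphic_on S"
    "\<And>z. z \<in> S \<Longrightarrow> F z = poly h z + poly Q z * g z"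
proof -
  have "\<exists>(h :: complex poly) g. g holomorphic_on S \<and> (\<forall>z\<in>S. F z = poly h z + poly Q z * g z)"
    using assms
  proof (induction "degree Q" arbitrary: Q F)
    case 0
    then obtain c where c: "Q = [:c:]" "c \<noteq> 0"
      by (metis degree_eq_zeroE pCons_0_0)
    have "(\<lambda>z. F z / c) holomorphic_on S"
      using 0 c by (intro holomorphic_intros) auto
    then show ?case using c
      by (intro exI[of _ 0] exI[of _ "\<lambda>z. F z / c"]) auto
  next
    case (Suc n)
    have "\<not> constant (poly Q)" using Suc.hyps(2) by (simp add: constant_degree)
    then obtain a where "poly Q a = 0" using Fundamental_Theorem_Algebra.fundamental_theorem_of_algebra by blast
    then obtain Q' where Q': "Q = [:- a, 1:] * Q'" by (metis dvdE poly_eq_0_iff_dvd)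
    with Suc.prems have "Q' \<noteq> 0" by auto
    have "degree Q = Suc (degree Q')" unfolding Q' using \<open>Q' \<noteq> 0\<close>
      by (subst degree_mult_eq) auto
    then have "n = degree Q'" using Suc.hyps(2) by simp
    \<comment> \<open>The root \<open>a\<close> may lie outside \<open>S\<close>. Then
      \<open>F a\<close> is just some constant, and the division identity below still holds.\<close>
    define G where "G = (\<lambda>z. if z = a then deriv F a else (F z - F a) / (z - a))"
    have "G holomorphic_on S" unfolding G_def
      by (rule pole_lemma_open) (use Suc.prems in auto)
    have G: "F z = F a + (z - a) * G z" for z by (simp add: G_def)
    obtain h g where hg: "g holomorphic_on S" "\<And>z. z \<in> S \<Longrightarrow> G z = poly h z + poly Q' z * g z"
      using Suc.hyps(1)[OF \<open>n = degree Q'\<close> \<open>G holomorphic_on S\<close> Suc.prems(2) \<open>Q' \<noteq> 0\<close>] by blast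
    have "F z = poly ([:F a:] + [:- a, 1:] * h) z + poly Q z * g z" if "z \<in> S" for z
      by (subst G) (simp add: hg(2)[OF that] Q' algebra_simps)
    then show ?case using hg(1) by blast
  qed
  then show ?thesis using that by blast
qed

text \<open>A holomorphic function that is not identically zero has finitely many zeros in
  \<open>K\<close>. Dividing out one of them to its full order lowers their number, so the induction
  is on that count. Zeros outside \<open>K\<close> may survive in \<open>k\<close>.\<close>

lemma holomorphic_poly_factorization:
  fixes f :: "complex \<Rightarrow> complex"
  assumes "f holomorphic_on S" "open S" "connected S" "w \<in> S" "f w \<noteq> 0" "compact K" "K \<subseteq> S"
  obtains Q :: "complex poly" and k where "Q \<noteq> 0" "k holomorphic_on S"
    "\<And>z. z \<in> S \<Longrightarrow> f z = poly Q z * k z" "\<And>z. z \<in> K \<Longrightarrow> k z \<noteq> 0"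
proof -
  have "\<exists>(Q :: complex poly) k. Q \<noteq> 0 \<and> k holomorphic_on S \<and>
      (\<forall>z\<in>S. f z = poly Q z * k z) \<and> (\<forall>z\<in>K. k z \<noteq> 0)"
    using assms(1,5)
  proof (induction "card {z\<in>K. f z = 0}" arbitrary: f rule: less_induct)
    case less
    show ?case
    proof (cases "\<exists>a\<in>K. f a = 0")
      case False
      then show ?thesis using less.prems by (intro exI[of _ 1] exI[of _ f]) auto
    next
      case True
      then obtain a where a: "a \<in> K" "f a = 0" by blast
      then have "a \<in> S" using assms(7) by blast
      \<comment> \<open>The point \<open>w\<close> witnesses that \<open>f\<close> is not
        identically zero, and it keeps doing so for the quotient \<open>G\<close>, so the induction
        hypothesis applies.\<close>
      have nc: "\<not> f constant_on S"
        using a \<open>a \<in> S\<close> less.prems assms(4) by (metis constant_on_def)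
      obtain g r n where g: "0 < n" "0 < r" "ball a r \<subseteq> S" "g holomorphic_on ball a r"
          "\<And>w. w \<in> ball a r \<Longrightarrow> f w = (w - a) ^ n * g w" "\<And>w. w \<in> ball a r \<Longrightarrow> g w \<noteq> 0"
        by (rule holomorphic_factor_zero_nonconstant[OF less.prems(1) assms(2,3) \<open>a \<in> S\<close> a(2) nc]) blast
      \<comment> \<open>On the punctured disc the local factor \<open>g\<close> equals the quotient,
        so the two branches glue to a holomorphic function.\<close>
      define G where "G = (\<lambda>z. if z \<in> ball a r then g z else f z / (z - a) ^ n)"
      have "G holomorphic_on (ball a r \<union> (S - {a}))"
        unfolding G_def using g assms(2) less.prems(1)
        by (intro holomorphic_on_If_Un holomorphic_intros open_delete)
           (auto intro: holomorphic_on_subset)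
      moreover have "ball a r \<union> (S - {a}) = S" using g by auto
      ultimately have "G holomorphic_on S" by simp
      have fG: "f z = (z - a) ^ n * G z" for z
        using g(5)[of z] \<open>0 < r\<close> by (auto simp: G_def)
      have "{z\<in>K. G z = 0} \<subset> {z\<in>K. f z = 0}"
      proof
        show "{z\<in>K. G z = 0} \<subseteq> {z\<in>K. f z = 0}" using fG by auto
        have "G a \<noteq> 0" using g by (simp add: G_def)
        then show "{z\<in>K. G z = 0} \<noteq> {z\<in>K. f z = 0}" using a by blast
      qed
      moreover have "finite {z\<in>K. f z = 0}"
        using holomorphic_compact_finite_zeros[OF less.prems(1) assms(2,3,6,7) nc] .
      ultimately have "card {z\<in>K. G z = 0} < card {z\<in>K. f z = 0}"
        using psubset_card_mono by blast
      moreover have "G w \<noteq> 0" using fG less.prems(2) by auto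
      ultimately obtain Q k where Qk: "Q \<noteq> 0" "k holomorphic_on S"
          "\<And>z. z \<in> S \<Longrightarrow> G z = poly Q z * k z" "\<And>z. z \<in> K \<Longrightarrow> k z \<noteq> 0"
        using less.hyps[OF _ \<open>G holomorphic_on S\<close>] by blast
      show ?thesis
        using Qk fG by (intro exI[of _ "[:- a, 1:] ^ n * Q"] exI[of _ k]) (auto simp: algebra_simps)
    qed
  qed
  then show ?thesis using that by blast
qed

section \<open>Fixed points depending holomorphically on a parameter\<close>

text \<open>Banach's theorem gives a fixed point for each \<open>w\<close> separately. Holomorphy in
  \<open>w\<close> comes from the iterates of the zero function: they are holomorphic and converge
  geometrically at a rate independent of \<open>w\<close>. Hypothesis \<open>hol\<close> asks only
  for substitution of holomorphic functions, which avoids functions of two complex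
  variables.\<close>

lemma holomorphic_fixed_point:
  fixes T :: "complex \<Rightarrow> complex \<Rightarrow> complex"
  assumes "open A" "0 \<le> \<delta>"
    and bound: "\<And>w x. \<lbrakk>w \<in> A; norm x \<le> \<delta>\<rbrakk> \<Longrightarrow> norm (T w x) \<le> \<delta>"
    and contr: "\<And>w x y. \<lbrakk>w \<in> A; norm x \<le> \<delta>; norm y \<le> \<delta>\<rbrakk> \<Longrightarrow> dist (T w x) (T w y) \<le> dist x y / 2"
    and hol: "\<And>u. \<lbrakk>u holomorphic_on A; \<And>w. w \<in> A \<Longrightarrow> norm (u w) \<le> \<delta>\<rbrakk> \<Longrightarrow> (\<lambda>w. T w (u w)) holomorphic_on A"
  obtains u where "u holomorphic_on A" "\<And>w. w \<in> A \<Longrightarrow> norm (u w) \<le> \<delta>" "\<And>w. w \<in> A \<Longrightarrow> T w (u w) = u w"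
proof -
  have "\<exists>x. norm x \<le> \<delta> \<and> T w x = x" if "w \<in> A" for w
  proof -
    have "\<exists>!x. x \<in> cball 0 \<delta> \<and> T w x = x"
    proof (rule Banach_fix[of _ "1/2"])
      show "complete (cball (0::complex) \<delta>)" by (simp add: complete_eq_closed)
      show "cball (0::complex) \<delta> \<noteq> {}" using assms(2) by simp
      show "T w ` cball 0 \<delta> \<subseteq> cball 0 \<delta>" using bound[OF that] by auto
      show "dist (T w x) (T w y) \<le> 1 / 2 * dist x y" if "x \<in> cball 0 \<delta>" "y \<in> cball 0 \<delta>" for x y
        using contr[OF \<open>w \<in> A\<close>] that by simp
    qed auto
    then show ?thesis by auto
  qed
  then obtain u where u: "\<And>w. w \<in> A \<Longrightarrow> norm (u w) \<le> \<delta> \<and> T w (u w) = u w" by metis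
  define U where "U n = ((\<lambda>v w. T w (v w)) ^^ n) (\<lambda>_. 0)" for n
  have U0: "U 0 = (\<lambda>_. 0)" and US: "U (Suc n) = (\<lambda>w. T w (U n w))" for n
    by (simp_all add: U_def)
  have U: "U n holomorphic_on A \<and> (\<forall>w\<in>A. norm (U n w) \<le> \<delta> \<and> dist (U n w) (u w) \<le> \<delta> * (1/2) ^ n)" for n
  proof (induction n)
    case 0
    then show ?case using assms(2) u by (auto simp: U0)
  next
    case (Suc n)
    have "dist (T w (U n w)) (u w) \<le> \<delta> * (1/2) ^ Suc n" if "w \<in> A" for w
    proof -
      have "dist (T w (U n w)) (T w (u w)) \<le> dist (U n w) (u w) / 2"
        using Suc u that by (intro contr) auto
      then show ?thesis using Suc u that by fastforce
    qed
    then show ?case using Suc hol[of "U n"] bound by (auto simp: US)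
  qed
  have "u holomorphic_on A"
  proof (rule holomorphic_uniform_sequence[OF assms(1)])
    show "U n holomorphic_on A" for n using U by blast
    fix x assume "x \<in> A"
    then obtain d where d: "0 < d" "cball x d \<subseteq> A" using assms(1) open_contains_cball by blast
    have "(\<lambda>n. \<delta> * (1/2) ^ n) \<longlonglongrightarrow> 0"
      by (intro tendsto_mult_right_zero LIMSEQ_power_zero) auto
    have "uniform_limit (cball x d) U u sequentially"
      unfolding uniform_limit_iff
    proof (intro allI impI)
      fix e :: real assume "0 < e"
      have "\<forall>\<^sub>F n in sequentially. \<delta> * (1/2) ^ n < e"
        using order_tendstoD(2)[OF \<open>(\<lambda>n. \<delta> * (1/2) ^ n) \<longlonglongrightarrow> 0\<close> \<open>0 < e\<close>] .
      then show "\<forall>\<^sub>F n in sequentially. \<forall>y\<in>cball x d. dist (U n y) (u y) < e"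
      proof eventually_elim
        case (elim n)
        then show ?case using U d(2) by (meson le_less_trans subsetD)
      qed
    qed
    then show "\<exists>d>0. cball x d \<subseteq> A \<and> uniform_limit (cball x d) U u sequentially"
      using d by blast
  qed
  then show ?thesis using that u by blast
qed

section \<open>The second-order Taylor remainder in integral form\<close>

text \<open>For \<open>h \<noteq> 0\<close> and \<open>F\<close> holomorphic on a convex open set
  containing both end points this is the quotient of \<open>F (w + h) - F w - h * deriv F w\<close>
  by the square of \<open>h\<close>. The integral also makes sense at \<open>h = 0\<close>, which
  matters because the increment will vanish at critical points of \<open>F\<close>.\<close>

definition taylor_remainder2 :: "(complex \<Rightarrow> complex) \<Rightarrow> complex \<Rightarrow> complex \<Rightarrow> complex" where
  "taylor_remainder2 F w h =
     integral {0..1} (\<lambda>t. (1 - of_real t) * deriv (deriv F) (w + of_real t * h))"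

lemma segment_in_convex:
  fixes w h :: complex
  assumes "convex A" "w \<in> A" "w + h \<in> A" "0 \<le> t" "t \<le> 1"
  shows "w + of_real t * h \<in> A"
proof -
  have "(1 - t) *\<^sub>R w + t *\<^sub>R (w + h) \<in> A"
    using assms by (intro convexD) auto
  then show ?thesis by (simp add: scaleR_conv_of_real algebra_simps)
qed

lemma taylor_remainder2_continuous:
  assumes "F holomorphic_on A" "open A" "convex A" "w \<in> A" "w + h \<in> A"
  shows "continuous_on {0..1} (\<lambda>t. (1 - of_real t) * deriv (deriv F) (w + of_real t * h))"
proof -
  have "deriv (deriv F) holomorphic_on A"
    using assms(1,2) by (intro holomorphic_deriv)
  then have "continuous_on A (deriv (deriv F))"
    by (rule holomorphic_on_imp_continuous_on)
  moreover have "continuous_on {0..1} (\<lambda>t. w + of_real t * h)"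
    by (intro continuous_intros)
  moreover have "(\<lambda>t. w + of_real t * h) ` {0..1} \<subseteq> A"
    using segment_in_convex[OF assms(3-5)] by auto
  ultimately have "continuous_on {0..1} (\<lambda>t. deriv (deriv F) (w + of_real t * h))"
    using continuous_on_compose2 by blast
  then show ?thesis by (intro continuous_intros)
qed

lemma taylor_remainder2:
  assumes "F holomorphic_on A" "open A" "convex A" "w \<in> A" "w + h \<in> A"
  shows "F (w + h) = F w + h * deriv F w + h\<^sup>2 * taylor_remainder2 F w h"
proof -
  \<comment> \<open>\<open>?G\<close> is an antiderivative of \<open>?g\<close>: the two terms with
    \<open>deriv F\<close> cancel upon differentiation. Its end values are \<open>F (w + h)\<close>
    and \<open>F w + h * deriv F w\<close>.\<close>
  let ?G = "\<lambda>t::complex. (1 - t) * h * deriv F (w + t * h) + F (w + t * h)"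
  let ?g = "\<lambda>t. h\<^sup>2 * ((1 - of_real t) * deriv (deriv F) (w + of_real t * h))"
  have holF': "deriv F holomorphic_on A"
    using assms(1,2) by (intro holomorphic_deriv)
  have "((\<lambda>t. ?G (of_real t)) has_vector_derivative ?g t) (at t within {0..1})" if t: "t \<in> {0..1}" for t
  proof (rule has_vector_derivative_real_field)
    have "w + of_real t * h \<in> A" using segment_in_convex assms t by auto
    then have D: "(F has_field_derivative deriv F (w + of_real t * h)) (at (w + of_real t * h))"
      "(deriv F has_field_derivative deriv (deriv F) (w + of_real t * h)) (at (w + of_real t * h))"
      using assms(1,2) holF' holomorphic_derivI by blast+
    have i: "((\<lambda>t. w + t * h) has_field_derivative h) (at (of_real t))"
      by (auto intro!: derivative_eq_intros)
    show "(?G has_field_derivative ?g t) (at (of_real t))"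
      by (rule derivative_eq_intros DERIV_chain2[OF D(1) i] DERIV_chain2[OF D(2) i] refl)+
         (simp add: algebra_simps power2_eq_square)
  qed
  then have "(?g has_integral ?G (of_real 1) - ?G (of_real 0)) {0..1}"
    by (intro fundamental_theorem_of_calculus) auto
  moreover have "integral {0..1} ?g = h\<^sup>2 * taylor_remainder2 F w h"
    unfolding taylor_remainder2_def by (rule integral_mult_right)
  ultimately show ?thesis
    by (simp add: integral_unique algebra_simps)
qed

lemma norm_taylor_remainder2_le:
  assumes "F holomorphic_on A" "open A" "convex A" "C \<subseteq> A" "convex C" "w \<in> C" "w + h \<in> C"
    and "\<And>z. z \<in> C \<Longrightarrow> norm (deriv (deriv F) z) \<le> M"
  shows "norm (taylor_remainder2 F w h) \<le> M"
proof -
  have "0 \<le> M" using assms(6,8) norm_ge_zero order_trans by blast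
  have "norm (taylor_remainder2 F w h) \<le> M * (1 - 0)"
    unfolding taylor_remainder2_def
  proof (rule integral_bound)
    show "continuous_on {0..1} (\<lambda>t. (1 - of_real t) * deriv (deriv F) (w + of_real t * h))"
      using assms by (intro taylor_remainder2_continuous[of F A]) auto
    fix t :: real assume t: "t \<in> {0..1}"
    have "norm (1 - complex_of_real t) = 1 - t"
      using t by (metis abs_of_nonneg atLeastAtMost_iff diff_ge_0_iff_ge norm_of_real of_real_1 of_real_diff)
    then have "norm ((1 - complex_of_real t) * deriv (deriv F) (w + of_real t * h)) \<le> 1 * M"
      unfolding norm_mult using t segment_in_convex[OF assms(5-7)] assms(8) \<open>0 \<le> M\<close>
      by (intro mult_mono) auto
    then show "norm ((1 - complex_of_real t) * deriv (deriv F) (w + of_real t * h)) \<le> M" by simp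
  qed simp
  then show ?thesis by simp
qed

text \<open>A bound on the third derivative makes the second one Lipschitz, and integration
  preserves this. The estimate serves to prove a contraction property.\<close>

lemma norm_taylor_remainder2_diff_le:
  assumes "F holomorphic_on A" "open A" "convex A" "C \<subseteq> A" "convex C"
    and "w \<in> C" "w + h \<in> C" "w + h' \<in> C"
    and "\<And>z. z \<in> C \<Longrightarrow> norm (deriv (deriv (deriv F)) z) \<le> L"
  shows "norm (taylor_remainder2 F w h - taylor_remainder2 F w h') \<le> L * norm (h - h')"
proof -
  have "0 \<le> L" using assms(6,9) norm_ge_zero order_trans by blast
  let ?f = "\<lambda>h t. (1 - complex_of_real t) * deriv (deriv F) (w + of_real t * h)"
  have cont: "continuous_on {0..1} (?f h)" "continuous_on {0..1} (?f h')"
    using assms by (auto intro!: taylor_remainder2_continuous[of F A])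
  have holF'': "deriv (deriv F) holomorphic_on A"
    using assms(1,2) by (intro holomorphic_deriv)
  have "taylor_remainder2 F w h - taylor_remainder2 F w h' = integral {0..1} (\<lambda>t. ?f h t - ?f h' t)"
    unfolding taylor_remainder2_def
    using cont by (intro integral_diff[symmetric] integrable_continuous_real)
  also have "norm \<dots> \<le> (L * norm (h - h')) * (1 - 0)"
  proof (rule integral_bound)
    show "continuous_on {0..1} (\<lambda>t. ?f h t - ?f h' t)"
      using cont by (rule continuous_on_diff)
    fix t :: real assume t: "t \<in> {0..1}"
    have 1: "norm (1 - complex_of_real t) = 1 - t"
      using t by (metis abs_of_nonneg atLeastAtMost_iff diff_ge_0_iff_ge norm_of_real of_real_1 of_real_diff)
    have "norm (deriv (deriv F) (w + of_real t * h) - deriv (deriv F) (w + of_real t * h'))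
        \<le> L * norm ((w + of_real t * h) - (w + of_real t * h'))"
    proof (rule field_differentiable_bound[of C])
      show "(deriv (deriv F) has_field_derivative deriv (deriv (deriv F)) z) (at z within C)" if "z \<in> C" for z
        using that assms(2,4) holF'' holomorphic_derivI by (meson has_field_derivative_at_within subsetD)
    qed (use assms segment_in_convex t in auto)
    also have "\<dots> = L * (t * norm (h - h'))"
    proof -
      have "(w + of_real t * h) - (w + of_real t * h') = of_real t * (h - h')"
        by (simp add: algebra_simps)
      then show ?thesis using t by (simp add: norm_mult)
    qed
    also have "\<dots> \<le> L * (1 * norm (h - h'))"
      using t \<open>0 \<le> L\<close> by (intro mult_left_mono mult_right_mono) auto
    finally have *: "norm (deriv (deriv F) (w + of_real t * h) - deriv (deriv F) (w + of_real t * h'))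
      \<le> L * norm (h - h')" by simp
    have "norm (?f h t - ?f h' t) = (1 - t) *
        norm (deriv (deriv F) (w + of_real t * h) - deriv (deriv F) (w + of_real t * h'))"
      by (simp only: norm_mult 1 flip: right_diff_distrib)
    also have "\<dots> \<le> 1 * (L * norm (h - h'))"
      using t * by (intro mult_mono) auto
    finally show "norm (?f h t - ?f h' t) \<le> L * norm (h - h')" by simp
  qed simp
  finally show ?thesis by simp
qed

text \<open>Differentiation under the integral sign; the third derivative of \<open>F\<close> enters
  through the chain rule.\<close>

lemma holomorphic_taylor_remainder2:
  assumes "F holomorphic_on A" "open A" "convex A"
    and "u holomorphic_on B" "open B" "convex B"
    and "\<And>w. w \<in> B \<Longrightarrow> w \<in> A \<and> w + u w \<in> A"
  shows "(\<lambda>w. taylor_remainder2 F w (u w)) holomorphic_on B"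
proof -
  let ?F2 = "deriv (deriv F)" and ?F3 = "deriv (deriv (deriv F))"
  let ?f = "\<lambda>w t. (1 - complex_of_real t) * ?F2 (w + of_real t * u w)"
  let ?f' = "\<lambda>w t. (1 - complex_of_real t) * (?F3 (w + of_real t * u w) * (1 + of_real t * deriv u w))"
  have hol2: "?F2 holomorphic_on A" and hol3: "?F3 holomorphic_on A" and holu': "deriv u holomorphic_on B"
    using assms by (auto intro!: holomorphic_deriv)
  have inA: "w + of_real t * u w \<in> A" if "w \<in> B" "0 \<le> t" "t \<le> 1" for w t
    using segment_in_convex[OF assms(3)] assms(7) that by blast
  have "(\<lambda>w. integral (cbox 0 1) (?f w)) holomorphic_on B"
  proof (rule leibniz_rule_holomorphic[where fx = ?f'])
    fix w and t :: real assume w: "w \<in> B" and t: "t \<in> cbox 0 1"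
    have D: "(?F2 has_field_derivative ?F3 (w + of_real t * u w)) (at (w + of_real t * u w))"
      using inA[OF w] t hol2 assms(2) by (intro holomorphic_derivI) auto
    have "(u has_field_derivative deriv u w) (at w within B)"
      using w assms(4,5) holomorphic_derivI by blast
    then have "((\<lambda>w. w + of_real t * u w) has_field_derivative (1 + of_real t * deriv u w)) (at w within B)"
      by (auto intro!: derivative_eq_intros)
    then show "((\<lambda>w. ?f w t) has_field_derivative ?f' w t) (at w within B)"
      by (intro DERIV_cmult DERIV_chain2[where g = "\<lambda>w. w + of_real t * u w", OF D])
  next
    fix w assume "w \<in> B"
    then show "?f w integrable_on cbox 0 1"
      using assms taylor_remainder2_continuous[of F A w "u w"] by (auto intro: integrable_continuous_real)
  next
    have "continuous_on A ?F3" "continuous_on B u" "continuous_on B (deriv u)"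
      using hol3 holu' assms(4) holomorphic_on_imp_continuous_on by blast+
    moreover have fst: "continuous_on (B \<times> cbox 0 1) (\<lambda>x :: complex \<times> real. fst x)"
      by (intro continuous_intros)
    moreover have "(\<lambda>x. fst x) ` (B \<times> cbox (0::real) 1) \<subseteq> B" by auto
    ultimately have c: "continuous_on (B \<times> cbox (0::real) 1) (\<lambda>x. u (fst x))"
      "continuous_on (B \<times> cbox (0::real) 1) (\<lambda>x. deriv u (fst x))"
      using continuous_on_compose2 by blast+
    have "continuous_on (B \<times> cbox 0 1) (\<lambda>x. fst x + of_real (snd x) * u (fst x))"
      by (intro continuous_intros c)
    moreover have "(\<lambda>x. fst x + of_real (snd x) * u (fst x)) ` (B \<times> cbox 0 1) \<subseteq> A"
      using inA by auto
    ultimately have "continuous_on (B \<times> cbox 0 1) (\<lambda>x. ?F3 (fst x + of_real (snd x) * u (fst x)))"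
      using \<open>continuous_on A ?F3\<close> continuous_on_compose2 by blast
    then show "continuous_on (B \<times> cbox 0 1) (\<lambda>(w, t). ?f' w t)"
      unfolding case_prod_beta by (intro continuous_intros c)
  qed fact
  then show ?thesis by (simp add: taylor_remainder2_def)
qed

section \<open>Inverting a small perturbation of the identity\<close>

text \<open>The outer margin \<open>d\<close> lets Cauchy's estimate bound \<open>deriv e\<close> by
  \<open>1 / 2\<close>, which gives injectivity on \<open>ball 0 s\<close>. The inner margin
  \<open>d\<close> lets Brouwer's theorem show that the image covers
  \<open>ball 0 (s - d)\<close>.\<close>

lemma near_identity_inverse:
  fixes e :: "complex \<Rightarrow> complex"
  assumes "e holomorphic_on ball 0 (s + d)" "0 < s" "0 < d"
    and bound: "\<And>w. w \<in> ball 0 (s + d) \<Longrightarrow> norm (e w) \<le> d / 2"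
  obtains \<phi> where "\<phi> holomorphic_on ball 0 (s - d)" "inj_on \<phi> (ball 0 (s - d))"
    "\<And>z. z \<in> ball 0 (s - d) \<Longrightarrow> \<phi> z \<in> ball 0 s \<and> \<phi> z + e (\<phi> z) = z"
proof -
  define \<psi> where "\<psi> w = w + e w" for w
  have sub: "ball 0 s \<subseteq> ball (0::complex) (s + d)" using \<open>0 < d\<close> by auto
  have hole: "e holomorphic_on ball 0 s"
    using assms(1) sub holomorphic_on_subset by blast
  have deriv_bound: "norm (deriv e w) \<le> 1 / 2" if w: "w \<in> ball 0 s" for w
  proof -
    have "cball w d \<subseteq> ball 0 (s + d)"
    proof
      fix x assume "x \<in> cball w d"
      then have "norm (x - w) \<le> d" by (simp add: dist_norm norm_minus_commute)
      then show "x \<in> ball 0 (s + d)"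
        using w norm_triangle_sub[of x w] by simp
    qed
    then have hol: "e holomorphic_on cball w d" using assms(1) holomorphic_on_subset by blast
    have "norm ((deriv ^^ 1) e w) \<le> fact 1 * (d / 2) / d ^ 1"
    proof (rule Cauchy_inequality)
      show "e holomorphic_on ball w d" using hol ball_subset_cball holomorphic_on_subset by blast
      show "continuous_on (cball w d) e" using hol holomorphic_on_imp_continuous_on by blast
      show "norm (e x) \<le> d / 2" if "norm (w - x) = d" for x
        using \<open>cball w d \<subseteq> ball 0 (s + d)\<close> that by (intro bound) (auto simp: dist_norm)
    qed fact
    then show ?thesis using \<open>0 < d\<close> by simp
  qed
  have lip: "norm (e x - e y) \<le> 1 / 2 * norm (x - y)" if "x \<in> ball 0 s" "y \<in> ball 0 s" for x y
  proof (rule field_differentiable_bound[of "ball 0 s"])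
    show "(e has_field_derivative deriv e z) (at z within ball 0 s)" if "z \<in> ball 0 s" for z
      using that hole holomorphic_derivI by blast
  qed (use that deriv_bound in auto)
  have inj: "inj_on \<psi> (ball 0 s)"
  proof (rule inj_onI)
    fix x y assume xy: "x \<in> ball 0 s" "y \<in> ball 0 s" "\<psi> x = \<psi> y"
    then have "x - y = e y - e x" by (simp add: \<psi>_def algebra_simps)
    then have "norm (x - y) = norm (e x - e y)" by (simp add: norm_minus_commute)
    then have "norm (x - y) \<le> 1 / 2 * norm (x - y)" using lip[OF xy(1,2)] by simp
    then show "x = y" by simp
  qed
  have "\<psi> holomorphic_on ball 0 s" unfolding \<psi>_def by (intro holomorphic_intros hole)
  then obtain \<phi> where \<phi>: "\<phi> holomorphic_on (\<psi> ` ball 0 s)" "\<And>w. w \<in> ball 0 s \<Longrightarrow> \<phi> (\<psi> w) = w"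
    using holomorphic_has_inverse[OF _ open_ball inj] by metis
  have surj: "\<exists>w\<in>ball 0 s. \<psi> w = z" if z: "z \<in> ball 0 (s - d)" for z
  proof -
    have "norm z < s - d" using z by simp
    then have "0 < s - d" using norm_ge_zero[of z] by linarith
    have sub': "cball 0 (s - d / 2) \<subseteq> ball (0::complex) s" using \<open>0 < d\<close> by auto
    \<comment> \<open>A solution is a fixed point of \<open>y \<mapsto> z - e y\<close>. With
      \<open>norm z < s - d\<close> and \<open>norm (e y) \<le> d / 2\<close> this map preserves the
      disc of radius \<open>s - d / 2\<close>.\<close>
    have "\<exists>w\<in>cball 0 (s - d / 2). \<psi> w = z"
    proof (rule brouwer_surjective_cball[where S = "ball 0 (s - d)"])
      show "continuous_on (cball 0 (s - d / 2)) \<psi>"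
        using \<open>\<psi> holomorphic_on ball 0 s\<close> sub' holomorphic_on_imp_continuous_on continuous_on_subset
        by blast
      show "x + (y - \<psi> y) \<in> cball 0 (s - d / 2)" if "x \<in> ball 0 (s - d)" "y \<in> cball 0 (s - d / 2)" for x y
      proof -
        have "norm (e y) \<le> d / 2" using that(2) sub' sub by (intro bound) blast
        then have "norm (x - e y) \<le> s - d / 2"
          using that(1) norm_triangle_ineq4[of x "e y"] by simp
        then show ?thesis by (simp add: \<psi>_def)
      qed
    qed (use \<open>0 < s - d\<close> \<open>0 < d\<close> z in auto)
    then show ?thesis using sub' by blast
  qed
  have \<phi>\<psi>: "\<phi> z \<in> ball 0 s \<and> \<psi> (\<phi> z) = z" if "z \<in> ball 0 (s - d)" for z
    using surj[OF that] \<phi>(2) by metis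
  show ?thesis
  proof
    show "\<phi> holomorphic_on ball 0 (s - d)"
    proof (rule holomorphic_on_subset[OF \<phi>(1)])
      show "ball 0 (s - d) \<subseteq> \<psi> ` ball 0 s"
        using surj by blast
    qed
    show "inj_on \<phi> (ball 0 (s - d))"
      using \<phi>\<psi> by (metis inj_onI)
    show "\<And>z. z \<in> ball 0 (s - d) \<Longrightarrow> \<phi> z \<in> ball 0 s \<and> \<phi> z + e (\<phi> z) = z"
      using \<phi>\<psi> by (simp add: \<psi>_def)
  qed
qed

section \<open>Prescribing small changes of value by moving along the derivative\<close>

lemma continuous_on_compact_norm_bound:
  fixes f :: "'a::topological_space \<Rightarrow> 'b::real_normed_vector"
  assumes "compact K" "continuous_on K f"
  obtains B where "0 < B" "\<And>x. x \<in> K \<Longrightarrow> norm (f x) \<le> B"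
  using compact_imp_bounded[OF compact_continuous_image[OF assms(2,1)]]
  unfolding bounded_pos by auto

text \<open>Moving \<open>w\<close> by \<open>deriv F w * u\<close> changes \<open>F\<close> to
  first order by the square of the derivative times \<open>u\<close>. Changes of that shape are thus
  attainable by small displacements even near critical points, where general ones are not.\<close>

lemma small_perturbation_along_derivative:
  fixes F :: "complex \<Rightarrow> complex"
  assumes holF: "F holomorphic_on ball 0 R" and "s < R" "0 < \<tau>"
  obtains \<eta> where "0 < \<eta>" "\<And>\<epsilon>. \<lbrakk>\<epsilon> holomorphic_on ball 0 s; \<And>w. w \<in> ball 0 s \<Longrightarrow> norm (\<epsilon> w) \<le> \<eta>\<rbrakk>
    \<Longrightarrow> \<exists>e. e holomorphic_on ball 0 s \<and>
          (\<forall>w\<in>ball 0 s. norm (e w) \<le> \<tau> \<and> F (w + e w) = F w - (deriv F w)\<^sup>2 * \<epsilon> w)"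
proof -
  \<comment> \<open>The closed disc of radius \<open>t\<close> provides uniform derivative bounds,
    and the gap \<open>t - s\<close> leaves room for the displacement.\<close>
  define t where "t = (s + R) / 2"
  have t: "s < t" "t < R" using \<open>s < R\<close> by (auto simp: t_def)
  let ?C = "cball (0::complex) t"
  have sub: "?C \<subseteq> ball 0 R" using t by auto
  have hol1: "deriv F holomorphic_on ball 0 R" using holomorphic_deriv[OF holF open_ball] .
  have hol2: "deriv (deriv F) holomorphic_on ball 0 R" using holomorphic_deriv[OF hol1 open_ball] .
  have hol3: "deriv (deriv (deriv F)) holomorphic_on ball 0 R" using holomorphic_deriv[OF hol2 open_ball] .
  have cont: "continuous_on ?C (deriv F)" "continuous_on ?C (deriv (deriv F))"
      "continuous_on ?C (deriv (deriv (deriv F)))"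
    using hol1 hol2 hol3 sub continuous_on_subset holomorphic_on_imp_continuous_on by blast+
  obtain B where B: "0 < B" "\<And>z. z \<in> ?C \<Longrightarrow> norm (deriv F z) \<le> B"
    using continuous_on_compact_norm_bound[OF compact_cball cont(1)] by blast
  obtain M where M: "0 < M" "\<And>z. z \<in> ?C \<Longrightarrow> norm (deriv (deriv F) z) \<le> M"
    using continuous_on_compact_norm_bound[OF compact_cball cont(2)] by blast
  obtain L where L: "0 < L" "\<And>z. z \<in> ?C \<Longrightarrow> norm (deriv (deriv (deriv F)) z) \<le> L"
    using continuous_on_compact_norm_bound[OF compact_cball cont(3)] by blast
  \<comment> \<open>The first entry bounds the displacement by \<open>\<tau>\<close>, the second
    keeps displaced points in \<open>?C\<close>. The third controls the quadratic term, and together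
    with the last two it makes the map a contraction.\<close>
  define \<delta> where "\<delta> = Min {\<tau> / B, (t - s) / B, 1 / (8 * M), 1 / (4 * L * B), 1}"
  have "0 < \<delta>" unfolding \<delta>_def using \<open>0 < \<tau>\<close> t B M L by simp
  have "\<delta> \<le> \<tau> / B" "\<delta> \<le> (t - s) / B" "\<delta> \<le> 1 / (8 * M)" "\<delta> \<le> 1 / (4 * L * B)" "\<delta> \<le> 1"
    unfolding \<delta>_def by (rule Min_le; simp)+
  then have \<delta>: "B * \<delta> \<le> \<tau>" "B * \<delta> \<le> t - s" "8 * (\<delta> * M) \<le> 1" "4 * (\<delta> * L * B) \<le> 1" "\<delta> \<le> 1"
    using B(1) M(1) L(1) by (simp_all add: field_simps)
  let ?A = "ball (0::complex) s"
  have AC: "?A \<subseteq> ?C" using t by auto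
  have step: "norm (deriv F w * x) \<le> B * \<delta>" "w + deriv F w * x \<in> ?C"
    if "w \<in> ?A" "norm x \<le> \<delta>" for w x
  proof -
    show *: "norm (deriv F w * x) \<le> B * \<delta>"
      unfolding norm_mult using that AC B \<open>0 < \<delta>\<close> by (intro mult_mono) auto
    have "norm w < s" using that by simp
    then have "norm (w + deriv F w * x) \<le> t"
      using * \<delta>(2) norm_triangle_ineq[of w "deriv F w * x"] by linarith
    then show "w + deriv F w * x \<in> ?C" by simp
  qed
  let ?S = "\<lambda>w x. taylor_remainder2 F w (deriv F w * x)"
  have S_le: "norm (?S w x) \<le> M" if "w \<in> ?A" "norm x \<le> \<delta>" for w x
    using that AC step(2)[OF that] M(2)
    by (intro norm_taylor_remainder2_le[OF holF open_ball convex_ball sub convex_cball]) auto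
  have S_diff: "norm (?S w x - ?S w y) \<le> L * B * norm (x - y)"
    if "w \<in> ?A" "norm x \<le> \<delta>" "norm y \<le> \<delta>" for w x y
  proof -
    have "norm (?S w x - ?S w y) \<le> L * norm (deriv F w * x - deriv F w * y)"
      using that AC step(2)[OF that(1,2)] step(2)[OF that(1,3)] L(2)
      by (intro norm_taylor_remainder2_diff_le[OF holF open_ball convex_ball sub convex_cball]) auto
    also have "\<dots> = L * (norm (deriv F w) * norm (x - y))"
      by (simp add: norm_mult flip: right_diff_distrib)
    also have "\<dots> \<le> L * (B * norm (x - y))"
      using L(1) B(2) that(1) AC by (intro mult_left_mono mult_right_mono) auto
    finally show ?thesis by (simp add: mult.assoc)
  qed
  show ?thesis
  \<comment> \<open>Half of \<open>\<delta>\<close> is granted to \<open>\<epsilon>\<close>; the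
    quadratic term uses the other half.\<close>
  proof (rule that[of "\<delta> / 2"])
    show "0 < \<delta> / 2" using \<open>0 < \<delta>\<close> by simp
    fix \<epsilon> :: "complex \<Rightarrow> complex"
    assume hol\<epsilon>: "\<epsilon> holomorphic_on ?A" and \<epsilon>: "\<And>w. w \<in> ?A \<Longrightarrow> norm (\<epsilon> w) \<le> \<delta> / 2"
    \<comment> \<open>With \<open>e = F' u\<close>, Taylor's formula turns the equation into \<open>F'\<^sup>2 (u + u\<^sup>2 S) = - F'\<^sup>2 \<epsilon>\<close>;
      cancelling \<open>F'\<^sup>2\<close> makes the fixed point problem uniform across the zeros of \<open>F'\<close>.\<close>
    define T where "T w x = - \<epsilon> w - x\<^sup>2 * ?S w x" for w x
    obtain u where u: "u holomorphic_on ?A" "\<And>w. w \<in> ?A \<Longrightarrow> norm (u w) \<le> \<delta>"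
      "\<And>w. w \<in> ?A \<Longrightarrow> T w (u w) = u w"
    proof (rule holomorphic_fixed_point[of ?A \<delta> T])
      fix w x :: complex assume w: "w \<in> ?A" and x: "norm x \<le> \<delta>"
      have "norm (x\<^sup>2 * ?S w x) \<le> \<delta>\<^sup>2 * M"
        unfolding norm_mult norm_power using x S_le[OF w x] \<open>0 < \<delta>\<close>
        by (intro mult_mono power_mono) auto
      also have "\<dots> = \<delta> * (\<delta> * M)" by (simp add: power2_eq_square)
      also have "\<dots> \<le> \<delta> * (1 / 2)" using \<open>0 < \<delta>\<close> \<delta>(3) by (intro mult_left_mono) auto
      finally have "norm (x\<^sup>2 * ?S w x) \<le> \<delta> / 2" by simp
      then show "norm (T w x) \<le> \<delta>"
        using \<epsilon>[OF w] norm_triangle_ineq4[of "- \<epsilon> w" "x\<^sup>2 * ?S w x"] by (simp add: T_def)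
    next
      fix w x y :: complex assume w: "w \<in> ?A" and x: "norm x \<le> \<delta>" and y: "norm y \<le> \<delta>"
      \<comment> \<open>The change of the square and the change of the remainder are separated; each
        contributes at most a quarter of \<open>norm (x - y)\<close>.\<close>
      have "T w y - T w x = (x - y) * (x + y) * ?S w x + y\<^sup>2 * (?S w x - ?S w y)"
        by (simp add: T_def algebra_simps power2_eq_square)
      also have "norm \<dots> \<le> norm ((x - y) * (x + y) * ?S w x) + norm (y\<^sup>2 * (?S w x - ?S w y))"
        by (rule norm_triangle_ineq)
      also have "norm ((x - y) * (x + y) * ?S w x) \<le> norm (x - y) * (2 * \<delta>) * M"
        unfolding norm_mult using S_le[OF w x] norm_triangle_ineq[of x y] x y \<open>0 < \<delta>\<close>
        by (intro mult_mono) auto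
      also have "\<dots> = norm (x - y) * (2 * (\<delta> * M))" by simp
      also have "\<dots> \<le> norm (x - y) * (1 / 4)"
        using \<delta>(3) by (intro mult_left_mono) auto
      also have "norm (y\<^sup>2 * (?S w x - ?S w y)) \<le> \<delta>\<^sup>2 * (L * B * norm (x - y))"
        unfolding norm_mult norm_power using S_diff[OF w x y] y \<open>0 < \<delta>\<close>
        by (intro mult_mono power_mono) auto
      also have "\<dots> = \<delta> * (norm (x - y) * (\<delta> * L * B))" by (simp add: power2_eq_square)
      also have "\<dots> \<le> 1 * (norm (x - y) * (1 / 4))"
        using \<delta>(4,5) \<open>0 < \<delta>\<close> L(1) B(1) by (intro mult_mono mult_left_mono) auto
      finally show "dist (T w x) (T w y) \<le> dist x y / 2"
        by (simp add: dist_norm norm_minus_commute)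
    next
      fix u assume u: "u holomorphic_on ?A" "\<And>w. w \<in> ?A \<Longrightarrow> norm (u w) \<le> \<delta>"
      have hol': "deriv F holomorphic_on ?A"
        using hol1 AC sub holomorphic_on_subset by blast
      have "(\<lambda>w. ?S w (u w)) holomorphic_on ?A"
        using AC sub step(2) u
        by (intro holomorphic_taylor_remainder2[OF holF open_ball convex_ball _ open_ball convex_ball]
            holomorphic_on_mult hol') blast+
      then show "(\<lambda>w. T w (u w)) holomorphic_on ?A"
        unfolding T_def by (intro holomorphic_intros hol\<epsilon> u)
    qed (use \<open>0 < \<delta>\<close> in auto)
    show "\<exists>e. e holomorphic_on ?A \<and>
        (\<forall>w\<in>?A. norm (e w) \<le> \<tau> \<and> F (w + e w) = F w - (deriv F w)\<^sup>2 * \<epsilon> w)"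
    proof (intro exI conjI ballI)
      show "(\<lambda>w. deriv F w * u w) holomorphic_on ?A"
        using hol1 AC sub u(1) holomorphic_on_subset by (intro holomorphic_on_mult) blast+
      fix w assume w: "w \<in> ?A"
      show "norm (deriv F w * u w) \<le> \<tau>"
        using step(1)[OF w u(2)[OF w]] \<delta>(1) by linarith
      have "F (w + deriv F w * u w) =
          F w + deriv F w * u w * deriv F w + (deriv F w * u w)\<^sup>2 * ?S w (u w)"
        using AC sub w step(2)[OF w u(2)[OF w]]
        by (intro taylor_remainder2[OF holF open_ball convex_ball]) blast+
      also have "\<dots> = F w + (deriv F w)\<^sup>2 * (u w + (u w)\<^sup>2 * ?S w (u w))"
        by (simp add: algebra_simps power2_eq_square)
      also have "u w + (u w)\<^sup>2 * ?S w (u w) = - \<epsilon> w"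
        using u(3)[OF w] by (simp add: T_def algebra_simps)
      finally show "F (w + deriv F w * u w) = F w - (deriv F w)\<^sup>2 * \<epsilon> w" by simp
    qed
  qed
qed

section \<open>The polynomial model on a disc\<close>

lemma polynomial_model_on_disc:
  fixes F :: "complex \<Rightarrow> complex"
  assumes holF: "F holomorphic_on ball 0 R" and "r < R"
  obtains p :: "complex poly" and \<phi> where "\<phi> holomorphic_on ball 0 r" "inj_on \<phi> (ball 0 r)"
    "\<And>z. z \<in> ball 0 r \<Longrightarrow> F z = poly p (\<phi> z)"
proof (cases "0 < r \<and> (\<exists>a\<in>ball 0 R. deriv F a \<noteq> 0)")
  \<comment> \<open>Here \<open>F\<close> is constant on \<open>ball 0 r\<close>, or that disc is
    empty, so the identity map with a constant polynomial suffices.\<close>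
  case False
  have "\<exists>c. \<forall>z\<in>ball 0 r. F z = c"
  proof (cases "0 < r")
    case True
    then have "\<forall>a\<in>ball 0 R. deriv F a = 0" using False by blast
    then have "F constant_on ball 0 R"
      using holF by (intro has_field_derivative_0_imp_constant_on) (auto intro: holomorphic_derivI[THEN DERIV_cong])
    then show ?thesis using \<open>r < R\<close> by (auto simp: constant_on_def)
  next
    case False
    then have "ball (0::complex) r = {}" by simp
    then show ?thesis by blast
  qed
  then obtain c where "\<And>z. z \<in> ball 0 r \<Longrightarrow> F z = c" by blast
  then show ?thesis by (intro that[of "\<lambda>z. z" "[:c:]"]) auto
next
  case True
  then obtain a where a: "a \<in> ball 0 R" "deriv F a \<noteq> 0" and "0 < r" by blast
  \<comment> \<open>The radii are used as follows: \<open>r\<close> for the domain of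
    \<open>\<phi>\<close>, \<open>r + d\<close> for its values, \<open>r + 2 * d\<close> for
    \<open>e\<close>, and the last gap up to \<open>R\<close> for uniform estimates on
    \<open>?K\<close>.\<close>
  define d where "d = (R - r) / 3"
  have d: "0 < d" "r + 2 * d < R" using \<open>r < R\<close> by (auto simp: d_def field_simps)
  let ?K = "cball (0::complex) (r + 2 * d)"
  have K: "?K \<subseteq> ball 0 R" using d by auto
  have "deriv F holomorphic_on ball 0 R" using holomorphic_deriv[OF holF open_ball] .
  then obtain Q k where Q: "Q \<noteq> 0" "k holomorphic_on ball 0 R"
      "\<And>z. z \<in> ball 0 R \<Longrightarrow> deriv F z = poly Q z * k z" "\<And>z. z \<in> ?K \<Longrightarrow> k z \<noteq> 0"
    using holomorphic_poly_factorization[of "deriv F" "ball 0 R" a ?K] a K by auto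
  have "Q\<^sup>2 \<noteq> 0" using Q(1) by simp
  obtain h g where hg: "g holomorphic_on ball 0 R"
      "\<And>z. z \<in> ball 0 R \<Longrightarrow> F z = poly h z + poly (Q\<^sup>2) z * g z"
    by (rule holomorphic_division_poly[OF holF open_ball \<open>Q\<^sup>2 \<noteq> 0\<close>]) blast
  obtain \<eta> where \<eta>: "0 < \<eta>" and pert: "\<And>\<epsilon>. \<lbrakk>\<epsilon> holomorphic_on ball 0 (r + 2 * d);
      \<And>w. w \<in> ball 0 (r + 2 * d) \<Longrightarrow> norm (\<epsilon> w) \<le> \<eta>\<rbrakk>
    \<Longrightarrow> \<exists>e. e holomorphic_on ball 0 (r + 2 * d) \<and>
          (\<forall>w\<in>ball 0 (r + 2 * d). norm (e w) \<le> d / 2 \<and> F (w + e w) = F w - (deriv F w)\<^sup>2 * \<epsilon> w)"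
    using small_perturbation_along_derivative[OF holF d(2), of "d / 2"] d(1) by auto
  have hol_inv: "(\<lambda>w. 1 / (k w)\<^sup>2) holomorphic_on ?K"
    using Q(4) by (intro holomorphic_intros holomorphic_on_subset[OF Q(2) K]) auto
  obtain C where C: "0 < C" "\<And>z. z \<in> ?K \<Longrightarrow> norm (1 / (k z)\<^sup>2) \<le> C"
    using continuous_on_compact_norm_bound[OF compact_cball holomorphic_on_imp_continuous_on[OF hol_inv]]
    by blast
  \<comment> \<open>The factor \<open>1 / C\<close> compensates for the later division by the square
    of \<open>k\<close>.\<close>
  obtain q where q: "\<And>z. z \<in> ?K \<Longrightarrow> norm (g z - poly q z) < \<eta> / C"
    using poly_approximation[OF hg(1) d(2), of "\<eta> / C"] \<eta> C(1) by auto
  define p where "p = h + Q\<^sup>2 * q"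
  define \<epsilon> where "\<epsilon> w = (g w - poly q w) * (1 / (k w)\<^sup>2)" for w
  have bK: "ball 0 (r + 2 * d) \<subseteq> ?K" by auto
  have "(\<lambda>w. g w - poly q w) holomorphic_on ball 0 R"
    by (intro holomorphic_intros hg(1))
  then have "(\<lambda>w. g w - poly q w) holomorphic_on ball 0 (r + 2 * d)"
    using bK K holomorphic_on_subset by blast
  then have "\<epsilon> holomorphic_on ball 0 (r + 2 * d)"
    unfolding \<epsilon>_def
    using holomorphic_on_subset[OF hol_inv bK] by (rule holomorphic_on_mult)
  moreover have "norm (\<epsilon> w) \<le> \<eta>" if "w \<in> ball 0 (r + 2 * d)" for w
  proof -
    have "norm (\<epsilon> w) \<le> \<eta> / C * C"
      unfolding \<epsilon>_def norm_mult using q[of w] C that bK \<eta>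
      by (intro mult_mono) (auto intro: less_imp_le)
    then show ?thesis using C(1) by simp
  qed
  \<comment> \<open>This spelling matches the inversion lemma with \<open>s = r + d\<close>, whose
    inverse then lives on \<open>ball 0 (r + d - d)\<close>, that is
    \<open>ball 0 r\<close>.\<close>
  moreover have rd: "r + d + d = r + 2 * d" by simp
  ultimately obtain e where e: "e holomorphic_on ball 0 (r + d + d)"
      "\<And>w. w \<in> ball 0 (r + d + d) \<Longrightarrow> norm (e w) \<le> d / 2"
      "\<And>w. w \<in> ball 0 (r + d + d) \<Longrightarrow> F (w + e w) = F w - (deriv F w)\<^sup>2 * \<epsilon> w"
    using pert[of \<epsilon>] unfolding rd by blast
  obtain \<phi> where \<phi>: "\<phi> holomorphic_on ball 0 (r + d - d)" "inj_on \<phi> (ball 0 (r + d - d))"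
      "\<And>z. z \<in> ball 0 (r + d - d) \<Longrightarrow> \<phi> z \<in> ball 0 (r + d) \<and> \<phi> z + e (\<phi> z) = z"
    using near_identity_inverse[OF e(1) _ d(1) e(2)] \<open>0 < r\<close> d(1) by auto
  have Fe: "F (w + e w) = poly p w" if "w \<in> ball 0 (r + d)" for w
  proof -
    have "w \<in> ball 0 (r + d + d)" "w \<in> ?K" using that d(1) by auto
    then have "w \<in> ball 0 R" using K by blast
    have "F (w + e w) = F w - (deriv F w)\<^sup>2 * \<epsilon> w" using e(3) \<open>w \<in> ball 0 (r + d + d)\<close> .
    also have "\<dots> = poly h w + (poly Q w)\<^sup>2 * g w - (poly Q w * k w)\<^sup>2 * \<epsilon> w"
      using Q(3) hg(2) \<open>w \<in> ball 0 R\<close> by simp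
    \<comment> \<open>As \<open>k\<close> has no zero on \<open>?K\<close>, its square cancels
      against the denominator in \<open>\<epsilon>\<close>.\<close>
    also have "(poly Q w * k w)\<^sup>2 * \<epsilon> w = (poly Q w)\<^sup>2 * (g w - poly q w)"
      using Q(4)[OF \<open>w \<in> ?K\<close>] by (simp add: \<epsilon>_def power_mult_distrib)
    finally show ?thesis by (simp add: p_def algebra_simps)
  qed
  show ?thesis
  proof (rule that[of \<phi> p])
    show "F z = poly p (\<phi> z)" if "z \<in> ball 0 r" for z
      using \<phi>(3)[of z] Fe[of "\<phi> z"] that by simp
  qed (use \<phi> in auto)
qed


section \<open>Transfer to a Jordan domain by the Riemann map\<close>

theorem theorem3p1:
  fixes D :: "complex set" and f :: "complex \<Rightarrow> complex"
  assumes "Jordan_domain D"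
    and "\<exists>U. open U \<and> closure D \<subseteq> U \<and> f analytic_on U"
  shows "\<exists>(p :: complex poly) (\<phi> :: complex \<Rightarrow> complex).
           \<phi> analytic_on D \<and> inj_on \<phi> D \<and> (\<forall>z\<in>D. f z = poly p (\<phi> z))"
proof -
  obtain \<gamma> where \<gamma>: "simple_path \<gamma>" "pathfinish \<gamma> = pathstart \<gamma>"
      "D \<in> components (- path_image \<gamma>)" "bounded D"
    using assms(1) unfolding Jordan_domain_def by blast
  note D = closure_Jordan_component[OF \<gamma>]
  have "D \<noteq> {}" using \<gamma>(3) in_components_nonempty by blast
  obtain V where V: "open V" "closure D \<subseteq> V" "f analytic_on V" using assms(2) by blast
  obtain U where U: "open U" "simply_connected U" "bounded U" "closure D \<subseteq> U" "U \<subseteq> V"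
    using simply_connected_nbhd[OF D(2-4) V(1,2)] by blast
  have "U \<noteq> {}" using U(4) \<open>D \<noteq> {}\<close> closure_subset by blast
  \<comment> \<open>Boundedness of \<open>U\<close> rules out the whole plane, the exceptional case
    of the Riemann mapping theorem.\<close>
  moreover have "U \<noteq> UNIV" using U(3) not_bounded_UNIV by blast
  ultimately obtain \<alpha> \<beta> where \<alpha>: "\<alpha> holomorphic_on U" and \<beta>: "\<beta> holomorphic_on ball 0 1"
      and \<alpha>\<beta>: "\<And>z. z \<in> U \<Longrightarrow> \<alpha> z \<in> ball 0 1 \<and> \<beta> (\<alpha> z) = z"
      and \<beta>\<alpha>: "\<And>z. z \<in> ball 0 1 \<Longrightarrow> \<beta> z \<in> U \<and> \<alpha> (\<beta> z) = z"
    using Riemann_mapping_theorem[of U] U(1,2) by blast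
  have "f holomorphic_on U"
    using V(3) U(5) analytic_imp_holomorphic holomorphic_on_subset by blast
  then have hol: "(\<lambda>z. f (\<beta> z)) holomorphic_on ball 0 1"
    using holomorphic_on_compose_gen[OF \<beta>, of f U] \<beta>\<alpha> by (simp add: o_def image_subset_iff)
  \<comment> \<open>Mapping the compact closure rather than \<open>D\<close> alone is what yields a
    radius \<open>r\<close> strictly below 1, as the disc model requires.\<close>
  have "compact (\<alpha> ` closure D)"
    using \<alpha> U(4) D(2) compact_continuous_image continuous_on_subset holomorphic_on_imp_continuous_on
    by metis
  moreover have "\<alpha> ` closure D \<subseteq> ball 0 1" using \<alpha>\<beta> U(4) by blast
  ultimately obtain r where r: "r < 1" "\<alpha> ` closure D \<subseteq> ball 0 r"
  proof -
    assume *: "\<And>r. \<lbrakk>r < 1; \<alpha> ` closure D \<subseteq> ball 0 r\<rbrakk> \<Longrightarrow> thesis"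
      and c: "compact (\<alpha> ` closure D)" and s: "\<alpha> ` closure D \<subseteq> ball 0 1"
    have "\<alpha> ` closure D \<noteq> {}" using \<open>D \<noteq> {}\<close> by simp
    moreover have "continuous_on (\<alpha> ` closure D) norm" by (intro continuous_intros)
    ultimately obtain y where y: "y \<in> \<alpha> ` closure D" "\<And>x. x \<in> \<alpha> ` closure D \<Longrightarrow> norm x \<le> norm y"
      using continuous_attains_sup[OF c] by blast
    have "norm y < 1" using y(1) s by auto
    show thesis
    \<comment> \<open>Halfway between the largest modulus on the image and 1, because
      \<open>ball 0 r\<close> is open and must contain the maximizer \<open>y\<close>.\<close>
    proof (rule *[of "(norm y + 1) / 2"])
      show "(norm y + 1) / 2 < 1" using \<open>norm y < 1\<close> by simp
      show "\<alpha> ` closure D \<subseteq> ball 0 ((norm y + 1) / 2)"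
        using y(2) \<open>norm y < 1\<close> by fastforce
    qed
  qed
  obtain p \<psi> where \<psi>: "\<psi> holomorphic_on ball 0 r" "inj_on \<psi> (ball 0 r)"
      "\<And>z. z \<in> ball 0 r \<Longrightarrow> f (\<beta> z) = poly p (\<psi> z)"
    using polynomial_model_on_disc[OF hol r(1)] by blast
  have DU: "D \<subseteq> U" using U(4) closure_subset by blast
  have Dr: "\<alpha> ` D \<subseteq> ball 0 r" using r(2) closure_subset by blast
  show ?thesis
  proof (intro exI conjI ballI)
    have "\<psi> \<circ> \<alpha> holomorphic_on D"
      using holomorphic_on_compose_gen[OF holomorphic_on_subset[OF \<alpha> DU] \<psi>(1) Dr] .
    then show "\<psi> \<circ> \<alpha> analytic_on D" using D(1) by (simp add: analytic_on_open)
    have "inj_on \<alpha> D" using \<alpha>\<beta> DU by (metis inj_onI subsetD)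
    then show "inj_on (\<psi> \<circ> \<alpha>) D" using inj_on_subset[OF \<psi>(2) Dr] by (rule comp_inj_on)
    show "f z = poly p ((\<psi> \<circ> \<alpha>) z)" if "z \<in> D" for z
    proof -
      have "\<alpha> z \<in> ball 0 r" "z \<in> U" using Dr DU that by blast+
      then show ?thesis using \<psi>(3)[of "\<alpha> z"] \<alpha>\<beta>[of z] by (metis comp_apply)
    qed
  qed
qed

end
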